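(* The occupation-binding constraint $\mathcal O=\{(\alpha,w)\in\mathcal U:\alpha=\operatorname{occ}(w)\}$ is not rectangular on $\mathcal U$.
   Context: $Q_3$ is the $1$-skeleton (graph) of the three-dimensional cube, with vertex set $V=\{0,1\}^3$ and coordinates numbered $0,1,2$; two vertices are adjacent iff they differ in exactly one coordinate. The basepoint is $o=000$. A walk is $w=(o;a_1a_2\cdots a_n)$ with $n\ge0$, $a_k\in\{0,1,2\}$; its vertex sequence is $v_0=o,v_1,\ldots,v_n$, where $v_k$ is obtained from $v_{k-1}$ by flipping coordinate $a_k$. It is closed if $v_n=o$. $\mathcal W$ is the set (monoid under concatenation) of all based closed walks. $\mathcal A=\mathbb Z^V$ is the group of integer-valued functions on $V$, and $\mathcal U=\mathcal A\times\mathcal W$. For $w\in\mathcal W$ with vertex sequence $(v_0,\ldots,v_n)$, $\operatorname{occ}(w)\in\mathcal A$ is defined by $\operatorname{occ}(w)(p)=\#\{k:0\le k<n,\ v_k=p\}$. A subset $P\subseteq\mathcal U$ is rectangular if $P=P_{\mathcal A}\times P_{\mathcal W}$ for some subsets $P_{\mathcal A}\subseteq\mathcal A$ and $P_{\mathcal W}\subseteq\mathcal W$. *)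

theory Defs
  imports Main "HOL-Library.Numeral_Type"
begin

text \<open>
  The type \<open>3\<close> has exactly the elements \<open>0, 1, 2\<close> (the coordinates), and the type \<open>2\<close> exactly
  the elements \<open>0, 1\<close>, with arithmetic modulo 2. So \<^typ>\<open>3 \<Rightarrow> 2\<close> is the vertex set of the
  three-dimensional cube.
\<close>

type_synonym coord = 3
type_synonym vertex = "coord \<Rightarrow> 2"

definition basepoint :: vertex where
  "basepoint = (\<lambda>_. 0)"

text \<open>Addition is modulo 2, so adding 1 exchanges 0 and 1.\<close>

definition flip :: "coord \<Rightarrow> vertex \<Rightarrow> vertex" where
  "flip a v = v(a := v a + 1)"

text \<open>
  A walk starts at the basepoint, so it is given by its list of flipped coordinates;
  concatenation of closed walks is list append.
\<close>

type_synonym walk = "coord list"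

text \<open>The vertex \<open>v\<^sub>k\<close> reached after the first \<open>k\<close> steps, meaningful for \<open>k \<le> length w\<close>.\<close>

definition walk_vertex :: "walk \<Rightarrow> nat \<Rightarrow> vertex" where
  "walk_vertex w k = fold flip (take k w) basepoint"

definition closed_walks :: "walk set" where
  "closed_walks = {w. walk_vertex w (length w) = basepoint}"

definition vertex_functions :: "(vertex \<Rightarrow> int) set" where
  "vertex_functions = UNIV"

definition config_space :: "((vertex \<Rightarrow> int) \<times> walk) set" where
  "config_space = vertex_functions \<times> closed_walks"

definition occ :: "walk \<Rightarrow> vertex \<Rightarrow> int" where
  "occ w p = int (card {k. k < length w \<and> walk_vertex w k = p})"

definition rectangular :: "((vertex \<Rightarrow> int) \<times> walk) set \<Rightarrow> bool" where
  "rectangular P \<longleftrightarrow>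
    (\<exists>PA PW. PA \<subseteq> vertex_functions \<and> PW \<subseteq> closed_walks \<and> P = PA \<times> PW)"

definition occupation_binding :: "((vertex \<Rightarrow> int) \<times> walk) set" where
  "occupation_binding = {(\<alpha>, w). (\<alpha>, w) \<in> config_space \<and> \<alpha> = occ w}"

end

theory Submission
  imports Defs
begin

text \<open>
  The constraint is the graph of \<^const>\<open>occ\<close>, and a rectangular graph of a function forces that
  function to be constant. But \<^const>\<open>occ\<close> is not constant on closed walks: the empty walk has
  occupation 0 at the basepoint, while a walk that crosses an edge and returns, like every
  nonempty walk, has positive occupation there, since it starts there.
\<close>

lemma mem_occupation_binding:
  "(\<alpha>, w) \<in> occupation_binding \<longleftrightarrow> w \<in> closed_walks \<and> \<alpha> = occ w"
  by (auto simp: occupation_binding_def config_space_def vertex_functions_def)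

lemma Nil_closed: "[] \<in> closed_walks"
  by (simp add: closed_walks_def walk_vertex_def)

lemma backtrack_closed: "[a, a] \<in> closed_walks"
  by (simp add: closed_walks_def walk_vertex_def flip_def basepoint_def fun_eq_iff)

lemma occ_Nil: "occ [] p = 0"
  by (simp add: occ_def)

lemma occ_basepoint_pos:
  assumes "w \<noteq> []"
  shows "occ w basepoint > 0"
proof -
  have "0 \<in> {k. k < length w \<and> walk_vertex w k = basepoint}"
    using assms by (simp add: walk_vertex_def)
  moreover have "finite {k. k < length w \<and> walk_vertex w k = basepoint}"
    by simp
  ultimately show ?thesis
    unfolding occ_def by (metis card_gt_0_iff empty_iff of_nat_0_less_iff)
qed

text \<open>A product containing the graph points over \<open>u\<close> and \<open>w\<close> also contains the mixed pair
  \<open>(occ u, w)\<close>.\<close>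

lemma rectangular_imp_occ_constant:
  assumes "rectangular occupation_binding" "u \<in> closed_walks" "w \<in> closed_walks"
  shows "occ u = occ w"
proof -
  obtain PA PW where P: "occupation_binding = PA \<times> PW"
    using assms(1) unfolding rectangular_def by blast
  have "(occ u, u) \<in> PA \<times> PW" "(occ w, w) \<in> PA \<times> PW"
    using assms(2,3) by (simp_all flip: P add: mem_occupation_binding)
  then have "(occ u, w) \<in> occupation_binding"
    by (simp add: P)
  then show ?thesis
    by (simp add: mem_occupation_binding)
qed

theorem proposition8p1:
  shows "\<not> rectangular occupation_binding"
proof
  assume "rectangular occupation_binding"
  then have "occ [] = occ [0, 0]"
    using Nil_closed backtrack_closed by (rule rectangular_imp_occ_constant)
  then show False
    using occ_Nil[of basepoint] occ_basepoint_pos[of "[0, 0]"] by simp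
qed

end
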